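(* Let $u:\mathbb{R}_+\to\mathbb{R}^n$ be a piecewise continuous function that is of persistent excitation (PE) and uniformly bounded by $u_M$, i.e. $\|u(t)\|\le u_M$ for all $t\ge0$. Then, for any $p>0$, the origin $x=0$ of the system $$\dot{x}(t)=-\lceil u^T(t)x(t)\rfloor^{p}\,u(t),\qquad x(t)\in\mathbb{R}^n,$$ is globally uniformly asymptotically stable.
   Context: Notation: for $w\in\mathbb{R}$ and an exponent $p>0$, $\lceil w\rfloor^p:=|w|^p\,\mathrm{sign}(w)$, with $\mathrm{sign}(0)=0$. $\|\cdot\|$ is the Euclidean norm. Solutions are absolutely continuous functions satisfying the differential equation for almost every $t\ge t_0$. Persistent excitation (PE): a piecewise continuous $u:\mathbb{R}_+\to\mathbb{R}^n$ is of PE if there exist $T>0$ and $\epsilon>0$ such that $\frac{1}{T}\int_{t}^{t+T}|u^T(s)w|\,ds\ge\epsilon$ for all $t\ge 0$ and all $w\in\mathbb{R}^n$ with $\|w\|=1$. "Uniformly" in asymptotic stability means uniformly in the initial time $t_0\ge 0$. *)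

theory Defs
  imports "HOL-Analysis.Analysis"
begin

definition signed_powr :: "real \<Rightarrow> real \<Rightarrow> real"
  where "signed_powr w p = \<bar>w\<bar> powr p * sgn w"

(* Functions on [0, \<infinity>) are represented by total functions on the reals; their values at
   negative arguments are never used. The value at a jump is arbitrary. *)
definition piecewise_continuous :: "(real \<Rightarrow> 'a::topological_space) \<Rightarrow> bool"
  where "piecewise_continuous u \<longleftrightarrow>
    (\<forall>b\<ge>0. \<exists>S. finite S \<and> (\<forall>t\<in>{0..b} - S. continuous (at t within {0..}) u)) \<and>
    (\<forall>t\<ge>0. \<exists>l. (u \<longlongrightarrow> l) (at_right t)) \<and>
    (\<forall>t>0. \<exists>l. (u \<longlongrightarrow> l) (at_left t))"

definition persistently_exciting :: "(real \<Rightarrow> 'a::euclidean_space) \<Rightarrow> bool"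
  where "persistently_exciting u \<longleftrightarrow>
    (\<exists>T>0. \<exists>\<epsilon>>0. \<forall>t\<ge>0. \<forall>w. norm w = 1 \<longrightarrow>
      (1 / T) * integral {t..t + T} (\<lambda>s. \<bar>u s \<bullet> w\<bar>) \<ge> \<epsilon>)"

(* A finite family of non-overlapping closed intervals is a division of its own union;
   each member K is the interval from Inf K to Sup K. *)
definition absolutely_continuous_fun_on :: "real set \<Rightarrow> (real \<Rightarrow> 'a::real_normed_vector) \<Rightarrow> bool"
  where "absolutely_continuous_fun_on I x \<longleftrightarrow>
    (\<forall>\<epsilon>>0. \<exists>\<delta>>0. \<forall>D. D division_of \<Union>D \<and> \<Union>D \<subseteq> I \<and> (\<Sum>K\<in>D. Sup K - Inf K) < \<delta> \<longrightarrow>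
      (\<Sum>K\<in>D. norm (x (Sup K) - x (Inf K))) < \<epsilon>)"

(* On unbounded or half-open intervals absolute continuity is understood locally,
   that is, on every compact subinterval. *)
definition ode_solution_on ::
  "(real \<Rightarrow> 'a \<Rightarrow> 'a::euclidean_space) \<Rightarrow> real set \<Rightarrow> (real \<Rightarrow> 'a) \<Rightarrow> bool"
  where "ode_solution_on f J x \<longleftrightarrow>
    (\<forall>a b. {a..b} \<subseteq> J \<longrightarrow> absolutely_continuous_fun_on {a..b} x) \<and>
    (AE t\<in>J in lebesgue. (x has_vector_derivative f t (x t)) (at t within J))"

(* Solutions starting at time t0, on any interval with left end point t0. Quantifying over
   these, rather than only over solutions on [t0, \<infinity>), ensures that solutions with finite
   escape time are not disregarded by the stability notions below. *)
definition solution_from ::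
  "(real \<Rightarrow> 'a \<Rightarrow> 'a::euclidean_space) \<Rightarrow> real \<Rightarrow> real set \<Rightarrow> (real \<Rightarrow> 'a) \<Rightarrow> bool"
  where "solution_from f t0 J x \<longleftrightarrow>
    is_interval J \<and> t0 \<in> J \<and> J \<subseteq> {t0..} \<and> ode_solution_on f J x"

definition forward_complete :: "(real \<Rightarrow> 'a \<Rightarrow> 'a::euclidean_space) \<Rightarrow> bool"
  where "forward_complete f \<longleftrightarrow>
    (\<forall>t0\<ge>0. \<forall>x0. \<exists>x. solution_from f t0 {t0..} x \<and> x t0 = x0)"

(* Uniform stability of the origin, where \<delta> = \<delta>(\<epsilon>) does not depend on t0. *)
definition uniformly_stable_with ::
  "(real \<Rightarrow> 'a \<Rightarrow> 'a::euclidean_space) \<Rightarrow> (real \<Rightarrow> real) \<Rightarrow> bool"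
  where "uniformly_stable_with f \<delta> \<longleftrightarrow>
    (\<forall>\<epsilon>>0. \<delta> \<epsilon> > 0 \<and>
      (\<forall>t0\<ge>0. \<forall>J x. solution_from f t0 J x \<and> norm (x t0) < \<delta> \<epsilon> \<longrightarrow>
        (\<forall>t\<in>J. norm (x t) < \<epsilon>)))"

definition globally_uniformly_attractive :: "(real \<Rightarrow> 'a \<Rightarrow> 'a::euclidean_space) \<Rightarrow> bool"
  where "globally_uniformly_attractive f \<longleftrightarrow>
    (\<forall>c>0. \<forall>\<eta>>0. \<exists>T>0. \<forall>t0\<ge>0. \<forall>J x. solution_from f t0 J x \<and> norm (x t0) < c \<longrightarrow>
      (\<forall>t\<in>J. t \<ge> t0 + T \<longrightarrow> norm (x t) < \<eta>))"

(* The origin of x' = f(t, x) is globally uniformly asymptotically stable. Letting \<delta>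
   tend to infinity gives uniform boundedness of solutions. Solutions need not be unique, so
   the estimates are required of every solution; forward completeness provides that
   there is one for all initial data. *)
definition globally_uniformly_asymptotically_stable ::
  "(real \<Rightarrow> 'a \<Rightarrow> 'a::euclidean_space) \<Rightarrow> bool"
  where "globally_uniformly_asymptotically_stable f \<longleftrightarrow>
    forward_complete f \<and>
    (\<exists>\<delta>. uniformly_stable_with f \<delta> \<and> filterlim \<delta> at_top at_top) \<and>
    globally_uniformly_attractive f"

end

theory Submission
  imports Defs
begin

text \<open>
  Along solutions \<open>(norm x)\<^sup>2\<close> decreases at rate \<open>2 * \<bar>u \<bullet> x\<bar> powr (p + 1)\<close>, which gives uniform
  stability. Persistent excitation turns this into a loss bounded below over each excitation
  period as long as \<open>norm x \<ge> \<eta>\<close>, and boundedly many such periods exhaust the initial norm.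
  Solutions exist for every \<open>p > 0\<close>, although the field is not Lipschitz for \<open>p < 1\<close>, because it is
  dissipative: solutions of the delay equations \<open>x' t = F t (x (t - h))\<close> form a Cauchy family as \<open>h\<close>
  tends to \<open>0\<close>. The nonlinearity is truncated to keep these approximations bounded, and the
  decrease of the norm shows that the truncation is never active on the limit.
\<close>

subsection \<open>Absolutely continuous functions\<close>

text \<open>Two mismatches shape the argument. Derivatives exist only almost everywhere while
  absolute continuity is phrased through divisions, so the energy balance needs a fundamental
  theorem of calculus that treats the null set inside Henstock-Kurzweil sums. And excitation tests a
  fixed direction with the first power, whereas the energy balance controls power
  \<open>p + 1\<close> of \<open>u t \<bullet> x t\<close> along a moving state. Freezing the
  direction at the start of a period costs the drift of \<open>x\<close>; splitting at a threshold
  \<theta> trades one exponent for another in the same way for all \<open>p > 0\<close>, where a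
  convexity argument would have to distinguish \<open>p < 1\<close>. In the existence part, a delay
  turns each approximation into finitely many integrations of known data, and two approximations
  with different delays can be compared directly through the sign condition on the field.\<close>

lemma tagged_division_ofE_real:
  fixes a b :: real
  assumes "p tagged_division_of {a..b}" "(t, K) \<in> p"
  obtains u v where "K = {u..v}" "u \<le> t" "t \<le> v" "a \<le> u" "v \<le> b"
proof -
  obtain u v where "K = cbox u v" using tagged_division_ofD(4)[OF assms] by blast
  moreover have "t \<in> K" "K \<subseteq> {a..b}" using tagged_division_ofD(2,3)[OF assms] by auto
  ultimately show ?thesis using that[of u v] by auto
qed

lemma division_ofE_real:
  fixes D :: "real set set"
  assumes "D division_of S" "K \<in> D"
  obtains u v where "K = {u..v}" "u \<le> v" "u \<in> S" "v \<in> S"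
proof -
  obtain u v where "K = cbox u v" using division_ofD(4)[OF assms] by blast
  moreover have "K \<noteq> {}" "K \<subseteq> S" using division_ofD(2,3)[OF assms] by auto
  ultimately show ?thesis using that[of u v] by fastforce
qed

text \<open>Two entries with the same interval but different tags would have disjoint interiors, so
  the interval is a single point, which leaves room for one tag only. This lets sums over tags be
  read as sums over intervals, the form in which absolute continuity applies.\<close>

lemma tagged_division_snd_inj:
  fixes a b :: real
  assumes "p tagged_division_of {a..b}"
  shows "inj_on snd p"
proof (rule inj_onI)
  fix y z assume yz: "y \<in> p" "z \<in> p" "snd y = snd z"
  obtain s t K where y: "y = (s, K)" and z: "z = (t, K)"
    using yz(3) by (cases y; cases z) auto
  obtain c d where K: "K = {c..d}" "c \<le> s" "s \<le> d"
    using tagged_division_ofE_real[OF assms, of s K] yz(1) y by blast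
  have t: "t \<in> K" using tagged_division_ofD(2)[OF assms, of t K] yz(2) z by blast
  show "y = z"
  proof (rule ccontr)
    assume "y \<noteq> z"
    then have "interior K \<inter> interior K = {}"
      using tagged_division_ofD(5)[OF assms, of s K t K] yz(1,2) y z by blast
    then have "\<not> c < d" using K by simp
    then show False using K t \<open>y \<noteq> z\<close> y z by auto
  qed
qed

text \<open>The total length of the pieces tagged in \<open>N\<close> is a Riemann sum of the
  indicator of \<open>N\<close>, whose integral is 0.\<close>

lemma negligible_tags_gauge:
  fixes a b :: real
  assumes "negligible N" "0 < d"
  shows "\<exists>\<gamma>. gauge \<gamma> \<and> (\<forall>p. p tagged_division_of {a..b} \<and> \<gamma> fine p \<longrightarrow>
      (\<Sum>(t, K)\<in>{y\<in>p. fst y \<in> N}. Sup K - Inf K) < d)"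
proof -
  have "((indicator N :: real \<Rightarrow> real) has_integral 0) (cbox a b)"
    using assms(1) by (simp add: negligible_def)
  then obtain \<gamma> where g: "gauge \<gamma>"
    and h: "\<And>p. p tagged_division_of cbox a b \<Longrightarrow> \<gamma> fine p \<Longrightarrow>
      norm ((\<Sum>(t, K)\<in>p. measure lborel K *\<^sub>R (indicator N t :: real)) - 0) < d"
    unfolding has_integral using assms(2) by metis
  have "(\<Sum>(t, K)\<in>{y\<in>p. fst y \<in> N}. Sup K - Inf K) < d"
    if p: "p tagged_division_of {a..b}" "\<gamma> fine p" for p
  proof -
    have fin: "finite p" using p by blast
    have "(\<Sum>(t, K)\<in>{y\<in>p. fst y \<in> N}. Sup K - Inf K)
        = (\<Sum>(t, K)\<in>p. measure lborel K *\<^sub>R (indicator N t :: real))"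
    proof (rule sum.mono_neutral_cong_left[OF fin])
      show "(case x of (t, K) \<Rightarrow> Sup K - Inf K) = (case x of (t, K) \<Rightarrow> measure lborel K *\<^sub>R indicator N t)"
        if xN: "x \<in> {y\<in>p. fst y \<in> N}" for x
      proof -
        obtain t K where x: "x = (t, K)" "(t, K) \<in> p" "t \<in> N"
          using xN by (cases x) auto
        obtain c e where "K = {c..e}" "c \<le> t" "t \<le> e"
          using tagged_division_ofE_real[OF p(1) x(2)] .
        then show ?thesis using x by auto
      qed
    qed (auto simp: indicator_def split: if_splits)
    then show ?thesis using h[of p] p by (simp add: abs_less_iff)
  qed
  with g show ?thesis by (intro exI[of _ \<gamma>]) simp
qed

lemma absolutely_continuous_fun_onD:
  assumes "absolutely_continuous_fun_on I x" "0 < e"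
  shows "\<exists>d>0. \<forall>D. D division_of \<Union>D \<and> \<Union>D \<subseteq> I \<and> (\<Sum>K\<in>D. Sup K - Inf K) < d \<longrightarrow>
      (\<Sum>K\<in>D. norm (x (Sup K) - x (Inf K))) < e"
  using assms(1)[unfolded absolutely_continuous_fun_on_def, THEN spec, THEN mp, OF assms(2)] .

text \<open>Pieces tagged outside \<open>N\<close> are controlled by differentiability at the tag.
  Pieces tagged in \<open>N\<close> have small total length for a fine enough gauge, so absolute
  continuity bounds the sum of their increments. Each group contributes at most
  \<open>e0 / 2\<close>.\<close>

lemma absolutely_continuous_has_integral:
  fixes x :: "real \<Rightarrow> 'a::euclidean_space"
  assumes "a \<le> b" and ac: "absolutely_continuous_fun_on {a..b} x" and N: "negligible N"
    and vecd: "\<And>t. t \<in> {a..b} - N \<Longrightarrow> (x has_vector_derivative x' t) (at t within {a..b})"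
  shows "(x' has_integral (x b - x a)) {a..b}"
proof (rule has_integral_spike[OF N])
  \<comment> \<open>With value 0 on \<open>N\<close>, a term tagged in \<open>N\<close> consists of
    the increment of \<open>x\<close> alone.\<close>
  let ?g = "\<lambda>t. if t \<in> N then 0 else x' t"
  show "x' t = ?g t" if "t \<in> {a..b} - N" for t using that by simp
  show "(?g has_integral (x b - x a)) {a..b}"
  proof (cases "a = b")
    case True then show ?thesis by (simp add: has_integral_refl)
  next
    case False
    with \<open>a \<le> b\<close> have "a < b" by simp
    show ?thesis unfolding has_integral box_real[symmetric]
    proof (intro allI impI)
      fix e0 :: real assume "e0 > 0"
      define e where "e = e0 / 2 / (b - a)"
      have "e > 0" using \<open>e0 > 0\<close> \<open>a < b\<close> by (simp add: e_def)
      have "\<forall>t. \<exists>d>0. t \<in> {a..b} - N \<longrightarrow>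
         (\<forall>y\<in>{a..b}. norm (y-t) < d \<longrightarrow> norm (x y - x t - (y-t) *\<^sub>R x' t) \<le> e * norm (y-t))"
        using vecd[unfolded has_vector_derivative_def has_derivative_within_alt] \<open>e > 0\<close>
        by (meson zero_less_one)
      then obtain d where d: "\<And>t. 0 < d t"
         "\<And>t y. t \<in> {a..b} - N \<Longrightarrow> y \<in> {a..b} \<Longrightarrow> norm (y-t) < d t
            \<Longrightarrow> norm (x y - x t - (y-t) *\<^sub>R x' t) \<le> e * norm (y-t)"
        by metis
      obtain \<delta> where "\<delta> > 0" and "\<forall>D. D division_of \<Union>D \<and> \<Union>D \<subseteq> {a..b} \<and>
          (\<Sum>K\<in>D. Sup K - Inf K) < \<delta> \<longrightarrow> (\<Sum>K\<in>D. norm (x (Sup K) - x (Inf K))) < e0 / 2"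
        using absolutely_continuous_fun_onD[OF ac half_gt_zero[OF \<open>e0 > 0\<close>]] by (elim exE conjE)
      note \<delta> = this(2)[THEN spec, THEN mp, OF conjI[OF _ conjI]]
      obtain \<gamma> where \<gamma>: "gauge \<gamma>" "\<forall>p. p tagged_division_of {a..b} \<and> \<gamma> fine p \<longrightarrow>
          (\<Sum>(t, K)\<in>{y\<in>p. fst y \<in> N}. Sup K - Inf K) < \<delta>"
        using negligible_tags_gauge[OF N \<open>\<delta> > 0\<close>, of a b] by (elim exE conjE)
      show "\<exists>\<gamma>. gauge \<gamma> \<and> (\<forall>p. p tagged_division_of cbox a b \<and> \<gamma> fine p \<longrightarrow>
          norm ((\<Sum>(t, K)\<in>p. measure lborel K *\<^sub>R ?g t) - (x b - x a)) < e0)"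
      proof (rule exI[of _ "\<lambda>t. ball t (d t) \<inter> \<gamma> t"], intro conjI allI impI)
        show "gauge (\<lambda>t. ball t (d t) \<inter> \<gamma> t)"
          using d(1) gauge_ball_dependent \<gamma>(1) by (intro gauge_Int) auto
        fix p assume "p tagged_division_of cbox a b \<and> (\<lambda>t. ball t (d t) \<inter> \<gamma> t) fine p"
        then have p: "p tagged_division_of {a..b}" and f1: "(\<lambda>t. ball t (d t)) fine p" and f2: "\<gamma> fine p"
          by (auto simp: fine_Int)
        have fin: "finite p" using p by blast
        let ?N = "{y\<in>p. fst y \<in> N}"
        let ?h = "\<lambda>(t, K). measure lborel K *\<^sub>R ?g t - (x (Sup K) - x (Inf K))"
        have eq: "(\<Sum>(t, K)\<in>p. measure lborel K *\<^sub>R ?g t) - (x b - x a) = sum ?h p"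
          using additive_tagged_division_1[OF \<open>a \<le> b\<close> p, of x]
          by (simp add: sum_subtractf split_def)
        have split: "sum ?h p = sum ?h (p - ?N) + sum ?h ?N"
          by (rule sum.subset_diff) (use fin in auto)
        have reg: "norm (sum ?h (p - ?N)) \<le> (\<Sum>(t, K)\<in>p - ?N. e * (Sup K - Inf K))"
        proof (rule sum_norm_le)
          fix y assume y: "y \<in> p - ?N"
          obtain t K where ytK: "y = (t, K)" by (cases y)
          with y have tK: "(t, K) \<in> p" "t \<notin> N" by auto
          obtain u v where k: "K = {u..v}" and "u \<le> t" "t \<le> v" "a \<le> u" "v \<le> b"
            using tagged_division_ofE_real[OF p tK(1)] .
          then have "u \<le> v" "t \<in> K" and kab: "K \<subseteq> {a..b}" by auto
          have ball: "\<forall>y\<in>K. norm (y - t) < d t"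
            using f1 tK(1) unfolding fine_def by (fastforce simp: dist_norm norm_minus_commute)
          have uv: "u \<in> K" "v \<in> K" using \<open>u \<le> v\<close> k by auto
          \<comment> \<open>Straddle estimate: the tag lies between \<open>u\<close> and
            \<open>v\<close>, so both ends are compared with \<open>x t\<close> and the two
            distances add up to \<open>v - u\<close>.\<close>
          have "norm ((v - u) *\<^sub>R x' t - (x v - x u))
              = norm (x u - x t - (u - t) *\<^sub>R x' t - (x v - x t - (v - t) *\<^sub>R x' t))"
            by (auto simp: algebra_simps)
          also have "\<dots> \<le> norm (x u - x t - (u - t) *\<^sub>R x' t) + norm (x v - x t - (v - t) *\<^sub>R x' t)"
            by (rule norm_triangle_ineq4)
          also have "\<dots> \<le> e * norm (u - t) + e * norm (v - t)"
            using kab uv ball tK \<open>t \<in> K\<close> by (intro add_mono d(2)) auto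
          also have "\<dots> = e * (v - u)"
            using \<open>t \<in> K\<close> k by (auto simp: algebra_simps)
          finally show "norm (?h y) \<le> (case y of (t, K) \<Rightarrow> e * (Sup K - Inf K))"
            using k \<open>u \<le> v\<close> tK ytK by simp
        qed
        also have "\<dots> \<le> (\<Sum>(t, K)\<in>p. e * (Sup K - Inf K))"
        proof (rule sum_mono2[OF fin])
          fix y assume "y \<in> p - (p - ?N)"
          then obtain t K where tK: "y = (t, K)" "(t, K) \<in> p" by (cases y) auto
          obtain u v where "K = {u..v}" "u \<le> t" "t \<le> v"
            using tagged_division_ofE_real[OF p tK(2)] .
          then show "0 \<le> (case y of (t, K) \<Rightarrow> e * (Sup K - Inf K))"
            using tK \<open>e > 0\<close> by auto
        qed auto
        also have "\<dots> = e * (b - a)"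
          using additive_tagged_division_1[OF \<open>a \<le> b\<close> p, of "\<lambda>x. x"]
          by (simp add: sum_distrib_left[symmetric] split_def)
        also have "\<dots> = e0 / 2"
          by (rule nonzero_eq_divide_eq[THEN iffD1, OF _ e_def]) (use \<open>a < b\<close> in simp)
        finally have reg: "norm (sum ?h (p - ?N)) \<le> e0 / 2" .
        have inj: "inj_on snd ?N"
          using tagged_division_snd_inj[OF p] by (rule inj_on_subset) (rule Collect_restrict)
        have "p tagged_partial_division_of {a..b}"
          using p by (simp add: tagged_division_of_def)
        then have "?N tagged_partial_division_of {a..b}"
          by (rule tagged_partial_division_subset) (rule Collect_restrict)
        then have div: "snd ` ?N division_of \<Union>(snd ` ?N)"
          by (rule partial_division_of_tagged_division)
        have "norm (sum ?h ?N) \<le> (\<Sum>y\<in>?N. norm (x (Sup (snd y)) - x (Inf (snd y))))"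
          by (rule sum_norm_le) (auto simp: norm_minus_commute)
        also have "\<dots> = (\<Sum>K\<in>snd ` ?N. norm (x (Sup K) - x (Inf K)))"
          by (simp add: sum.reindex[OF inj])
        also have "\<dots> < e0 / 2"
        proof (rule \<delta>[OF div])
          show "\<Union>(snd ` ?N) \<subseteq> {a..b}"
          proof (rule UN_least)
            show "snd y \<subseteq> {a..b}" if "y \<in> ?N" for y
              using tagged_division_ofD(3)[OF p, of "fst y" "snd y"] that by simp
          qed
          show "(\<Sum>K\<in>snd ` ?N. Sup K - Inf K) < \<delta>"
            using \<gamma>(2)[THEN spec, THEN mp, OF conjI[OF p f2]] by (simp add: sum.reindex[OF inj] split_def)
        qed
        finally have "norm (sum ?h ?N) < e0 / 2" .
        then show "norm ((\<Sum>(t, K)\<in>p. measure lborel K *\<^sub>R ?g t) - (x b - x a)) < e0"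
          unfolding eq split using reg norm_triangle_ineq[of "sum ?h (p - ?N)" "sum ?h ?N"] by linarith
      qed
    qed
  qed
qed

lemma absolutely_continuous_fun_on_dominated:
  fixes x :: "real \<Rightarrow> 'a::real_normed_vector" and y :: "real \<Rightarrow> 'b::real_normed_vector"
  assumes x: "absolutely_continuous_fun_on I x"
    and le: "\<And>s t. s \<in> I \<Longrightarrow> t \<in> I \<Longrightarrow> norm (y t - y s) \<le> L * norm (x t - x s)"
  shows "absolutely_continuous_fun_on I y"
  unfolding absolutely_continuous_fun_on_def
proof (intro allI impI)
  fix e :: real assume "e > 0"
  \<comment> \<open>Positive whatever the sign of \<open>L\<close>, so that \<open>e / C\<close> is
    an admissible tolerance.\<close>
  define C where "C = \<bar>L\<bar> + 1"
  have "C > 0" by (simp add: C_def)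
  obtain d where "d > 0" and "\<forall>D. D division_of \<Union>D \<and> \<Union>D \<subseteq> I \<and>
      (\<Sum>K\<in>D. Sup K - Inf K) < d \<longrightarrow> (\<Sum>K\<in>D. norm (x (Sup K) - x (Inf K))) < e / C"
    using absolutely_continuous_fun_onD[OF x divide_pos_pos[OF \<open>e > 0\<close> \<open>C > 0\<close>]] by (elim exE conjE)
  note d = this(2)[THEN spec, THEN mp, OF conjI[OF _ conjI]]
  have "(\<Sum>K\<in>D. norm (y (Sup K) - y (Inf K))) < e"
    if D: "D division_of \<Union>D" "\<Union>D \<subseteq> I" "(\<Sum>K\<in>D. Sup K - Inf K) < d" for D
  proof -
    have "norm (y (Sup K) - y (Inf K)) \<le> C * norm (x (Sup K) - x (Inf K))" if KD: "K \<in> D" for K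
    proof -
      obtain u v where "K = {u..v}" "u \<le> v" "u \<in> \<Union>D" "v \<in> \<Union>D"
        using division_ofE_real[OF D(1) KD] .
      then have "Sup K \<in> I" "Inf K \<in> I" using subsetD[OF D(2)] by auto
      then have "norm (y (Sup K) - y (Inf K)) \<le> L * norm (x (Sup K) - x (Inf K))" using le by simp
      also have "\<dots> \<le> C * norm (x (Sup K) - x (Inf K))"
        by (intro mult_right_mono) (auto simp: C_def)
      finally show ?thesis .
    qed
    then have "(\<Sum>K\<in>D. norm (y (Sup K) - y (Inf K))) \<le> C * (\<Sum>K\<in>D. norm (x (Sup K) - x (Inf K)))"
      by (simp add: sum_distrib_left sum_mono)
    also have "\<dots> < C * (e / C)" using d[OF D] \<open>C > 0\<close> by (intro mult_strict_left_mono)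
    finally show ?thesis using \<open>C > 0\<close> by simp
  qed
  then show "\<exists>\<delta>>0. \<forall>D. D division_of \<Union>D \<and> \<Union>D \<subseteq> I \<and> (\<Sum>K\<in>D. Sup K - Inf K) < \<delta> \<longrightarrow>
      (\<Sum>K\<in>D. norm (y (Sup K) - y (Inf K))) < e"
    using \<open>d > 0\<close> by blast
qed

lemma lipschitz_absolutely_continuous_fun_on:
  fixes y :: "real \<Rightarrow> 'b::real_normed_vector"
  assumes "\<And>s t. s \<in> I \<Longrightarrow> t \<in> I \<Longrightarrow> norm (y t - y s) \<le> L * \<bar>t - s\<bar>"
  shows "absolutely_continuous_fun_on I y"
proof (rule absolutely_continuous_fun_on_dominated)
  show "absolutely_continuous_fun_on I (\<lambda>t. t)"
    unfolding absolutely_continuous_fun_on_def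
  proof (intro allI impI exI conjI; (elim conjE)?)
    \<comment> \<open>For the identity, increments are lengths, so \<delta> may be the tolerance
      itself.\<close>
    fix e :: real and D :: "real set set"
    assume D: "D division_of \<Union>D" "(\<Sum>K\<in>D. Sup K - Inf K) < e"
    have "norm (Sup K - Inf K) = Sup K - Inf K" if KD: "K \<in> D" for K
    proof -
      obtain u v where "K = {u..v}" "u \<le> v"
        using division_ofE_real[OF D(1) KD] .
      then show ?thesis by simp
    qed
    then show "(\<Sum>K\<in>D. norm (Sup K - Inf K)) < e" using D(2) by simp
  qed
  show "norm (y t - y s) \<le> L * norm (t - s)" if "s \<in> I" "t \<in> I" for s t
    using assms that by simp
qed

lemma absolutely_continuous_imp_continuous_on:
  fixes x :: "real \<Rightarrow> 'a::real_normed_vector"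
  assumes "absolutely_continuous_fun_on {a..b} x"
  shows "continuous_on {a..b} x"
  unfolding continuous_on_iff
proof (intro ballI allI impI)
  fix t e :: real assume "t \<in> {a..b}" "e > 0"
  obtain d where "d > 0" and "\<forall>D. D division_of \<Union>D \<and> \<Union>D \<subseteq> {a..b} \<and>
      (\<Sum>K\<in>D. Sup K - Inf K) < d \<longrightarrow> (\<Sum>K\<in>D. norm (x (Sup K) - x (Inf K))) < e"
    using absolutely_continuous_fun_onD[OF assms \<open>e > 0\<close>] by (elim exE conjE)
  note d = this(2)[THEN spec, THEN mp, OF conjI[OF _ conjI]]
  have *: "norm (x v - x u) < e" if "a \<le> u" "u \<le> v" "v \<le> b" "v - u < d" for u v
    using d[of "{{u..v}}"] that by (auto simp: division_of_self[of u v, simplified])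
  show "\<exists>d>0. \<forall>s\<in>{a..b}. dist s t < d \<longrightarrow> dist (x s) (x t) < e"
  proof (intro exI[of _ d] conjI ballI impI)
    fix s assume s: "s \<in> {a..b}" "dist s t < d"
    show "dist (x s) (x t) < e"
      using *[of s t] *[of t s] s \<open>t \<in> {a..b}\<close>
      by (cases "s \<le> t") (auto simp: dist_norm norm_minus_commute)
  qed fact
qed

subsection \<open>Energy decay along solutions\<close>

lemma bounded_continuous_off_finite_integrable:
  fixes h :: "real \<Rightarrow> 'a::euclidean_space"
  assumes "finite S" "continuous_on ({a..b} - S) h" "\<And>t. t \<in> {a..b} \<Longrightarrow> norm (h t) \<le> B"
  shows "h integrable_on {a..b}"
proof (rule integrable_spike_set)
  have "negligible S" using assms(1) by (rule negligible_finite)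
  show "h integrable_on {a..b} - S"
  proof (rule measurable_bounded_by_integrable_imp_integrable)
    show "{a..b} - S \<in> sets lebesgue"
      using \<open>negligible S\<close> by (simp add: negligible_imp_sets sets.Diff)
    then show "h \<in> borel_measurable (lebesgue_on ({a..b} - S))"
      by (rule continuous_imp_measurable_on_sets_lebesgue[OF assms(2)])
    show "(\<lambda>_. B) integrable_on {a..b} - S"
      by (rule integrable_spike_set[of _ "{a..b}"])
        (auto intro: negligible_subset[OF \<open>negligible S\<close>])
    show "norm (h t) \<le> B" if "t \<in> {a..b} - S" for t using assms(3) that by simp
  qed
  show "negligible {t \<in> {a..b} - S - {a..b}. h t \<noteq> 0}"
    by (rule negligible_subset[OF \<open>negligible S\<close>]) auto
  show "negligible {t \<in> {a..b} - ({a..b} - S). h t \<noteq> 0}"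
    by (rule negligible_subset[OF \<open>negligible S\<close>]) auto
qed

lemma ode_solution_on_derivative:
  assumes "ode_solution_on f J x"
  shows "\<exists>N. negligible N \<and> (\<forall>t\<in>J - N. (x has_vector_derivative f t (x t)) (at t within J))"
proof -
  from assms have "AE t in lebesgue. t \<in> J \<longrightarrow> (x has_vector_derivative f t (x t)) (at t within J)"
    by (simp add: ode_solution_on_def)
  then obtain N where "N \<in> null_sets lebesgue"
    and "{t. \<not> (t \<in> J \<longrightarrow> (x has_vector_derivative f t (x t)) (at t within J))} \<subseteq> N"
    unfolding eventually_ae_filter by auto
  then show ?thesis by (intro exI[of _ N]) (auto simp: negligible_iff_null_sets)
qed

lemma ode_solution_on_has_integral:
  assumes "ode_solution_on f J x" "{a..b} \<subseteq> J" "a \<le> b"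
  shows "((\<lambda>t. f t (x t)) has_integral (x b - x a)) {a..b}"
proof -
  obtain N where "negligible N"
    and N: "\<forall>t\<in>J - N. (x has_vector_derivative f t (x t)) (at t within J)"
    using ode_solution_on_derivative[OF assms(1)] by blast
  show ?thesis
  proof (rule absolutely_continuous_has_integral[OF assms(3) _ \<open>negligible N\<close>])
    show "absolutely_continuous_fun_on {a..b} x"
      using assms by (simp add: ode_solution_on_def)
    show "(x has_vector_derivative f t (x t)) (at t within {a..b})" if "t \<in> {a..b} - N" for t
      by (rule has_vector_derivative_within_subset[OF N[rule_format] assms(2)]) (use that assms(2) in auto)
  qed
qed

text \<open>The product rule holds off the same null set as the equation. The square is Lipschitz
  only on bounded sets, so absolute continuity is inherited from \<open>x\<close> through a bound
  \<open>B\<close> on the compact path.\<close>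

lemma ode_solution_on_norm_square_has_integral:
  assumes sol: "ode_solution_on f J x" and J: "{a..b} \<subseteq> J" and "a \<le> b"
  shows "((\<lambda>t. 2 * (x t \<bullet> f t (x t))) has_integral ((norm (x b))\<^sup>2 - (norm (x a))\<^sup>2)) {a..b}"
proof -
  obtain N where "negligible N"
    and N: "\<forall>t\<in>J - N. (x has_vector_derivative f t (x t)) (at t within J)"
    using ode_solution_on_derivative[OF sol] by blast
  have ac: "absolutely_continuous_fun_on {a..b} x"
    using sol J by (simp add: ode_solution_on_def)
  have "compact (x ` {a..b})"
    using absolutely_continuous_imp_continuous_on[OF ac] by (rule compact_continuous_image) simp
  then obtain B where B: "\<And>t. t \<in> {a..b} \<Longrightarrow> norm (x t) \<le> B"
    by (meson compact_imp_bounded bounded_iff imageI)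
  show ?thesis unfolding power2_norm_eq_inner
  proof (rule absolutely_continuous_has_integral[OF \<open>a \<le> b\<close> _ \<open>negligible N\<close>])
    show "absolutely_continuous_fun_on {a..b} (\<lambda>t. x t \<bullet> x t)"
    proof (rule absolutely_continuous_fun_on_dominated[OF ac])
      fix s t assume st: "s \<in> {a..b}" "t \<in> {a..b}"
      have "x t \<bullet> x t - x s \<bullet> x s = (x t + x s) \<bullet> (x t - x s)"
        unfolding inner_add_left inner_diff_right using inner_commute[of "x s" "x t"] by simp
      then have "norm (x t \<bullet> x t - x s \<bullet> x s) \<le> norm (x t + x s) * norm (x t - x s)"
        by (simp add: Cauchy_Schwarz_ineq2)
      also have "\<dots> \<le> (B + B) * norm (x t - x s)"
        by (intro mult_right_mono order_trans[OF norm_triangle_ineq] add_mono B st) simp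
      finally show "norm (x t \<bullet> x t - x s \<bullet> x s) \<le> (B + B) * norm (x t - x s)" .
    qed
    show "((\<lambda>t. x t \<bullet> x t) has_vector_derivative 2 * (x t \<bullet> f t (x t))) (at t within {a..b})"
      if "t \<in> {a..b} - N" for t
    proof -
      have "(x has_vector_derivative f t (x t)) (at t within {a..b})"
        by (rule has_vector_derivative_within_subset[OF N[rule_format] J]) (use that J in auto)
      from bounded_bilinear.has_vector_derivative[OF bounded_bilinear_inner this this]
      show ?thesis by (simp add: inner_commute)
    qed
  qed
qed

lemma ode_solution_on_norm_antimono:
  assumes sol: "ode_solution_on f J x" and J: "{a..b} \<subseteq> J" and "a \<le> b"
    and diss: "\<And>t y. t \<in> J \<Longrightarrow> y \<bullet> f t y \<le> 0"
  shows "norm (x b) \<le> norm (x a)"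
proof -
  have "(norm (x b))\<^sup>2 - (norm (x a))\<^sup>2 \<le> 0"
    by (rule has_integral_le[OF ode_solution_on_norm_square_has_integral[OF sol J \<open>a \<le> b\<close>] has_integral_0])
      (use diss J in \<open>auto simp: mult_le_0_iff\<close>)
  then show ?thesis by (simp add: power2_le_iff_abs_le)
qed

section \<open>Signed powers and exchange of exponents\<close>

lemma mult_signed_powr: "w * signed_powr w p = \<bar>w\<bar> powr (p + 1)"
  by (cases w "0::real" rule: linorder_cases) (simp_all add: signed_powr_def powr_add)

lemma abs_signed_powr: "\<bar>signed_powr w p\<bar> = \<bar>w\<bar> powr p"
  by (cases w "0::real" rule: linorder_cases) (simp_all add: signed_powr_def abs_mult)

text \<open>Below the threshold the first term suffices; above it
  \<open>g powr p / \<theta> powr p\<close> is at least 1. The energy integral of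
  \<open>g powr (p + 1)\<close> thereby bounds both the integral of \<open>g powr p\<close> (the
  speed) and that of \<open>g\<close> (the excitation), with errors that vanish with
  \<theta>.\<close>

lemma le_powr_interpolation:
  fixes g \<theta> p q :: real
  assumes "0 \<le> g" "0 < \<theta>" "0 \<le> q" "0 \<le> p"
  shows "g powr q \<le> \<theta> powr q + g powr (q + p) / \<theta> powr p"
proof (cases "g \<le> \<theta>")
  case True
  then have "g powr q \<le> \<theta> powr q" using assms by (intro powr_mono2) auto
  then show ?thesis by (simp add: add_increasing2)
next
  case False
  have "g powr q * \<theta> powr p \<le> g powr q * g powr p"
    using False assms by (intro mult_left_mono powr_mono2) auto
  also have "\<dots> = g powr (q + p)" by (simp add: powr_add)
  finally have "g powr q \<le> g powr (q + p) / \<theta> powr p" using assms by (simp add: pos_le_divide_eq)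
  then show ?thesis by (simp add: add_increasing)
qed

lemma exists_small_powr_sum:
  fixes A B p e :: real
  assumes "0 < p" "0 < e"
  obtains \<theta> where "0 < \<theta>" "A * \<theta> + B * \<theta> powr p < e"
proof -
  have "((\<lambda>\<theta>. A * \<theta> + B * \<theta> powr p) \<longlongrightarrow> A * 0 + B * 0) (at_right 0)"
    using \<open>0 < p\<close>
    by (intro tendsto_intros tendsto_zero_powrI[where b = p])
      (auto simp: eventually_at_right_less less_imp_le intro: eventually_mono[OF eventually_at_right_less])
  then have "\<forall>\<^sub>F \<theta> in at_right 0. A * \<theta> + B * \<theta> powr p < e"
    using \<open>0 < e\<close> by (simp add: order_tendsto_iff)
  then have "\<forall>\<^sub>F \<theta> in at_right 0. 0 < \<theta> \<and> A * \<theta> + B * \<theta> powr p < e"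
    by (intro eventually_conj eventually_at_right_less)
  then show ?thesis using that eventually_happens' trivial_limit_at_right_real by blast
qed

subsection \<open>Attractivity under persistent excitation\<close>

lemma piecewise_continuous_imp_continuous_on:
  assumes "piecewise_continuous u" "0 \<le> a"
  obtains S where "finite S" "continuous_on ({a..b} - S) u"
proof -
  obtain S where "finite S" and S: "\<forall>t\<in>{0..max 0 b} - S. continuous (at t within {0..}) u"
    using assms(1) unfolding piecewise_continuous_def by (meson max.cobounded1)
  have "continuous_on ({a..b} - S) u"
    unfolding continuous_on_eq_continuous_within
    by (intro ballI continuous_within_subset[OF S[rule_format]]) (use assms(2) in auto)
  with \<open>finite S\<close> show ?thesis by (rule that)
qed

text \<open>Over one excitation period, \<open>\<integral> \<bar>u \<bullet> x\<bar> powr (p + 1)\<close> is half the loss of squared norm. It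
  controls both the drift of \<open>x\<close> and \<open>\<integral> \<bar>u \<bullet> x\<bar>\<close>, so a small loss would contradict excitation in
  the direction \<open>x s\<close>.\<close>

lemma excitation_window_decrease:
  fixes u :: "real \<Rightarrow> 'a::euclidean_space"
  assumes pc: "piecewise_continuous u" and M: "\<And>t. 0 \<le> t \<Longrightarrow> norm (u t) \<le> M" and "0 < p"
    and "0 < T" "0 < e" "0 < \<eta>"
    and pe: "\<And>t w. 0 \<le> t \<Longrightarrow> norm w = 1 \<Longrightarrow> e \<le> 1 / T * integral {t..t + T} (\<lambda>s. \<bar>u s \<bullet> w\<bar>)"
  shows "\<exists>\<kappa>>0. \<forall>s J x. 0 \<le> s \<and> {s..s + T} \<subseteq> J \<and>
      ode_solution_on (\<lambda>t y. - (signed_powr (u t \<bullet> y) p *\<^sub>R u t)) J x \<and> \<eta> \<le> norm (x s) \<longrightarrow>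
      (norm (x (s + T)))\<^sup>2 \<le> (norm (x s))\<^sup>2 - \<kappa>"
proof -
  have "0 \<le> M" using M[of 0] norm_ge_zero order_trans by blast
  have "0 < e * T * \<eta> / 2" using \<open>0 < T\<close> \<open>0 < e\<close> \<open>0 < \<eta>\<close> by simp
  \<comment> \<open>The left side collects the parts of the final estimate that do not involve the
    loss: \<open>T * \<theta>\<close> from splitting \<open>g\<close>, the other from the drift.
    They may use up half of the guaranteed excitation \<open>e * T * \<eta>\<close>.\<close>
  then obtain \<theta> where "0 < \<theta>" and \<theta>: "T * \<theta> + T * T * M\<^sup>2 * \<theta> powr p < e * T * \<eta> / 2"
    using exists_small_powr_sum[OF \<open>0 < p\<close>] by blast
  \<comment> \<open>Coefficient of the half loss \<open>I (s + T)\<close> in the final estimate: the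
    first summand from splitting \<open>g\<close>, the second from the drift.\<close>
  define C where "C = 1 / \<theta> powr p + T * M\<^sup>2 / \<theta>"
  have "0 < C" using \<open>0 < \<theta>\<close> \<open>0 < T\<close> by (auto simp: C_def intro!: add_pos_nonneg)
  \<comment> \<open>The final estimate leaves \<open>e * T * \<eta> / 2 \<le> C * I (s + T)\<close>,
    and the loss of squared norm is twice \<open>I (s + T)\<close>.\<close>
  define \<kappa> where "\<kappa> = e * T * \<eta> / C"
  have "0 < \<kappa>" using \<open>0 < C\<close> \<open>0 < T\<close> \<open>0 < e\<close> \<open>0 < \<eta>\<close> by (simp add: \<kappa>_def)
  moreover have "\<forall>s J x. 0 \<le> s \<and> {s..s + T} \<subseteq> J \<and>
      ode_solution_on (\<lambda>t y. - (signed_powr (u t \<bullet> y) p *\<^sub>R u t)) J x \<and> \<eta> \<le> norm (x s) \<longrightarrow>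
      (norm (x (s + T)))\<^sup>2 \<le> (norm (x s))\<^sup>2 - \<kappa>"
  proof (intro allI impI, elim conjE)
    fix s J x
    assume "0 \<le> s" and J: "{s..s + T} \<subseteq> J" and "\<eta> \<le> norm (x s)"
      and sol: "ode_solution_on (\<lambda>t y. - (signed_powr (u t \<bullet> y) p *\<^sub>R u t)) J x"
    define g where "g t = \<bar>u t \<bullet> x t\<bar>" for t
    define I where "I r = ((norm (x s))\<^sup>2 - (norm (x r))\<^sup>2) / 2" for r
    have I: "((\<lambda>t. g t powr (p + 1)) has_integral I r) {s..r}" if r: "r \<in> {s..s + T}" for r
    proof -
      have "{s..r} \<subseteq> J" "s \<le> r" using J r by auto
      note int = has_integral_mult_right[OF ode_solution_on_norm_square_has_integral[OF sol this], of "- 1 / 2"]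
      have "- 1 / 2 * (2 * (x t \<bullet> - (signed_powr (u t \<bullet> x t) p *\<^sub>R u t))) = g t powr (p + 1)" for t
        by (simp add: g_def mult_signed_powr[symmetric] inner_commute mult.commute)
      moreover have "- 1 / 2 * ((norm (x r))\<^sup>2 - (norm (x s))\<^sup>2) = I r"
        by (simp add: I_def field_simps)
      ultimately show ?thesis using int by (simp only:)
    qed
    have I_mono: "I r \<le> I (s + T)" if r: "r \<in> {s..s + T}" for r
      by (rule has_integral_subset_le[OF _ I I]) (use r \<open>0 < T\<close> in auto)
    \<comment> \<open>Uses the loss over the full period, so that one bound serves every time in the
      window.\<close>
    define B where "B = M * (\<theta> powr p * T + I (s + T) / \<theta>)"
    have drift: "norm (x r - x s) \<le> B" if r: "r \<in> {s..s + T}" for r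
    proof -
      have rJ: "{s..r} \<subseteq> J" "s \<le> r" using J r by auto
      have "norm (x r - x s) \<le> M * (\<theta> powr p * (r - s) + I r / \<theta>)"
      proof -
        have f: "((\<lambda>t. - (signed_powr (u t \<bullet> x t) p *\<^sub>R u t)) has_integral (x r - x s)) {s..r}"
          by (rule ode_solution_on_has_integral[OF sol rJ])
        have h: "((\<lambda>t. M * (\<theta> powr p + g t powr (p + 1) / \<theta>)) has_integral
            M * (\<theta> powr p * (r - s) + I r / \<theta>)) {s..r}"
          using has_integral_mult_right[OF has_integral_add[OF has_integral_const_real[of "\<theta> powr p" s r]
            has_integral_divide[OF I[OF r], of \<theta>]], of M] rJ(2) by (simp add: mult.commute)
        have "norm (integral {s..r} (\<lambda>t. - (signed_powr (u t \<bullet> x t) p *\<^sub>R u t)))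
            \<le> integral {s..r} (\<lambda>t. M * (\<theta> powr p + g t powr (p + 1) / \<theta>))"
        proof (rule integral_norm_bound_integral)
          fix t assume t: "t \<in> {s..r}"
          have "norm (- (signed_powr (u t \<bullet> x t) p *\<^sub>R u t)) = norm (u t) * g t powr p"
            by (simp add: abs_signed_powr g_def)
          also have "\<dots> \<le> M * (\<theta> powr p + g t powr (p + 1) / \<theta> powr 1)"
            using t \<open>0 \<le> s\<close> \<open>0 \<le> M\<close> \<open>0 < \<theta>\<close> \<open>0 < p\<close>
            by (intro mult_mono M le_powr_interpolation) (auto simp: g_def)
          finally show "norm (- (signed_powr (u t \<bullet> x t) p *\<^sub>R u t))
              \<le> M * (\<theta> powr p + g t powr (p + 1) / \<theta>)"
            using \<open>0 < \<theta>\<close> by simp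
        qed (use f h in \<open>auto simp: has_integral_integrable\<close>)
        then show ?thesis unfolding integral_unique[OF f] integral_unique[OF h] .
      qed
      also have "\<dots> \<le> B"
        unfolding B_def using r I_mono[OF r] \<open>0 \<le> M\<close> \<open>0 < \<theta>\<close>
        by (intro mult_left_mono add_mono divide_right_mono) auto
      finally show ?thesis .
    qed
    obtain S where S: "finite S" "continuous_on ({s..s + T} - S) u"
      using piecewise_continuous_imp_continuous_on[OF pc \<open>0 \<le> s\<close>] .
    have "(\<lambda>t. \<bar>u t \<bullet> x s\<bar>) integrable_on {s..s + T}"
    proof (rule bounded_continuous_off_finite_integrable[OF S(1)])
      show "continuous_on ({s..s + T} - S) (\<lambda>t. \<bar>u t \<bullet> x s\<bar>)"
        by (intro continuous_intros S(2))
      show "norm \<bar>u t \<bullet> x s\<bar> \<le> M * norm (x s)" if "t \<in> {s..s + T}" for t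
        using Cauchy_Schwarz_ineq2[of "u t" "x s"] mult_right_mono[OF M[of t] norm_ge_zero[of "x s"]]
          that \<open>0 \<le> s\<close> by simp
    qed
    moreover have "((\<lambda>t. \<theta> + g t powr (p + 1) / \<theta> powr p + M * B) has_integral
        (T * \<theta> + I (s + T) / \<theta> powr p + T * (M * B))) {s..s + T}"
      using has_integral_add[OF has_integral_add[OF has_integral_const_real[of \<theta> s "s + T"]
          has_integral_divide[OF I[of "s + T"], of "\<theta> powr p"]]
          has_integral_const_real[of "M * B" s "s + T"]] \<open>0 < T\<close> by simp
    \<comment> \<open>The direction is frozen at \<open>x s\<close>, and the error
      \<open>u t \<bullet> (x t - x s)\<close> is paid for by the drift bound.\<close>
    moreover have "\<bar>u t \<bullet> x s\<bar> \<le> \<theta> + g t powr (p + 1) / \<theta> powr p + M * B" if t: "t \<in> {s..s + T}" for t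
    proof -
      have "\<bar>u t \<bullet> x s\<bar> \<le> g t + \<bar>u t \<bullet> (x t - x s)\<bar>"
        by (simp add: g_def inner_diff_right)
      also have "g t \<le> \<theta> + g t powr (p + 1) / \<theta> powr p"
        using le_powr_interpolation[of "g t" \<theta> 1 p] \<open>0 < \<theta>\<close> \<open>0 < p\<close> by (simp add: g_def add.commute)
      also have "\<bar>u t \<bullet> (x t - x s)\<bar> \<le> norm (u t) * norm (x t - x s)"
        by (rule Cauchy_Schwarz_ineq2)
      also have "\<dots> \<le> M * B"
        using t \<open>0 \<le> s\<close> \<open>0 \<le> M\<close> by (intro mult_mono M drift) auto
      finally show ?thesis by simp
    qed
    ultimately have "integral {s..s + T} (\<lambda>t. \<bar>u t \<bullet> x s\<bar>)
        \<le> T * \<theta> + I (s + T) / \<theta> powr p + T * (M * B)"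
      by (intro has_integral_le[OF integrable_integral])
    also have "\<dots> = (T * \<theta> + T * T * M\<^sup>2 * \<theta> powr p) + C * I (s + T)"
      by (simp add: B_def C_def algebra_simps power2_eq_square add_divide_distrib)
    finally have upper: "integral {s..s + T} (\<lambda>t. \<bar>u t \<bullet> x s\<bar>) \<le> e * T * \<eta> / 2 + C * I (s + T)"
      using \<theta> by linarith
    have "x s \<noteq> 0" using \<open>\<eta> \<le> norm (x s)\<close> \<open>0 < \<eta>\<close> by auto
    \<comment> \<open>Excitation is assumed for unit vectors only; rescaling by
      \<open>norm (x s)\<close> brings in the factor \<eta>.\<close>
    have "integral {s..s + T} (\<lambda>t. \<bar>u t \<bullet> x s\<bar>)
        = norm (x s) * integral {s..s + T} (\<lambda>t. \<bar>u t \<bullet> (x s /\<^sub>R norm (x s))\<bar>)"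
      using \<open>x s \<noteq> 0\<close> by (simp add: abs_mult)
    moreover have "e * T \<le> integral {s..s + T} (\<lambda>t. \<bar>u t \<bullet> (x s /\<^sub>R norm (x s))\<bar>)"
      using pe[OF \<open>0 \<le> s\<close>, of "x s /\<^sub>R norm (x s)"] \<open>x s \<noteq> 0\<close> \<open>0 < T\<close> by (simp add: field_simps)
    ultimately have "\<eta> * (e * T) \<le> integral {s..s + T} (\<lambda>t. \<bar>u t \<bullet> x s\<bar>)"
      using \<open>\<eta> \<le> norm (x s)\<close> \<open>0 < \<eta>\<close> \<open>0 < e\<close> \<open>0 < T\<close> by (auto intro: mult_mono)
    with upper have "e * T * \<eta> \<le> C * (2 * I (s + T))" by (simp add: mult_ac)
    then have "\<kappa> \<le> 2 * I (s + T)"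
      using \<open>0 < C\<close> by (simp add: \<kappa>_def pos_divide_le_eq mult_ac)
    then show "(norm (x (s + T)))\<^sup>2 \<le> (norm (x s))\<^sup>2 - \<kappa>" by (simp add: I_def)
  qed
  ultimately show ?thesis by (intro exI[of _ \<kappa>] conjI)
qed

lemma excitation_attractive:
  fixes u :: "real \<Rightarrow> 'a::euclidean_space"
  assumes pc: "piecewise_continuous u" and M: "\<And>t. 0 \<le> t \<Longrightarrow> norm (u t) \<le> M" and "0 < p"
    and "persistently_exciting u"
  shows "globally_uniformly_attractive (\<lambda>t y. - (signed_powr (u t \<bullet> y) p *\<^sub>R u t))"
    (is "globally_uniformly_attractive ?f")
  unfolding globally_uniformly_attractive_def
proof (intro allI impI)
  fix c \<eta> :: real assume "0 < c" "0 < \<eta>"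
  obtain T e where "0 < T" "0 < e"
    and pe: "\<And>t w. 0 \<le> t \<Longrightarrow> norm w = 1 \<Longrightarrow> e \<le> 1 / T * integral {t..t + T} (\<lambda>s. \<bar>u s \<bullet> w\<bar>)"
    using assms(4) unfolding persistently_exciting_def by (metis (no_types))
  have "\<exists>\<kappa>>0. \<forall>s J x. 0 \<le> s \<and> {s..s + T} \<subseteq> J \<and> ode_solution_on ?f J x \<and>
      \<eta> \<le> norm (x s) \<longrightarrow> (norm (x (s + T)))\<^sup>2 \<le> (norm (x s))\<^sup>2 - \<kappa>"
    by (rule excitation_window_decrease[OF pc M \<open>0 < p\<close> \<open>0 < T\<close> \<open>0 < e\<close> \<open>0 < \<eta>\<close> pe])
  then obtain \<kappa> where "0 < \<kappa>" and \<kappa>: "\<forall>s J x. 0 \<le> s \<and> {s..s + T} \<subseteq> J \<and> ode_solution_on ?f J x \<and>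
      \<eta> \<le> norm (x s) \<longrightarrow> (norm (x (s + T)))\<^sup>2 \<le> (norm (x s))\<^sup>2 - \<kappa>"
    by (elim exE conjE)
  \<comment> \<open>So many losses of \<kappa> exceed the initial squared norm. The waiting time
    \<open>n * T\<close> depends on \<open>c\<close> and \<eta> but not on the initial time.\<close>
  obtain n where n: "c\<^sup>2 < real n * \<kappa>"
    using reals_Archimedean3[OF \<open>0 < \<kappa>\<close>] by blast
  have "0 < n" using n \<open>0 < c\<close> by (cases n) (auto simp: not_less[symmetric])
  have "norm (x t) < \<eta>" if "0 \<le> t0" and sol: "solution_from ?f t0 J x" and c: "norm (x t0) < c"
    and t: "t \<in> J" "t0 + real n * T \<le> t" for t0 J x t
  proof (rule ccontr)
    assume "\<not> norm (x t) < \<eta>"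
    have ode: "ode_solution_on ?f J x" and sub: "{t0..t} \<subseteq> J"
      using sol t(1) unfolding solution_from_def is_interval_1 by auto
    have diss: "y \<bullet> ?f s y \<le> 0" for s y
      using mult_signed_powr[of "u s \<bullet> y" p] by (simp add: inner_commute mult.commute)
    \<comment> \<open>Since the norm never increases, being at least \<eta> at the final time forces
      this at all earlier times, and every window then loses \<kappa>.\<close>
    have ge: "\<eta> \<le> norm (x s)" if "s \<in> {t0..t}" for s
    proof -
      have "norm (x t) \<le> norm (x s)"
        using that sub by (intro ode_solution_on_norm_antimono[OF ode _ _ diss]) auto
      then show ?thesis using \<open>\<not> norm (x t) < \<eta>\<close> by simp
    qed
    have "(norm (x (t0 + real k * T)))\<^sup>2 \<le> (norm (x t0))\<^sup>2 - real k * \<kappa>" if "k \<le> n" for k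
      using that
    proof (induction k)
      case (Suc k)
      have le: "t0 + real (Suc k) * T \<le> t"
        using t(2) mult_right_mono[of "real (Suc k)" "real n" T] Suc.prems \<open>0 < T\<close> by linarith
      have eq: "t0 + real k * T + T = t0 + real (Suc k) * T" by (simp add: algebra_simps)
      have pos: "0 \<le> real k * T" using \<open>0 < T\<close> by simp
      have "(norm (x (t0 + real k * T + T)))\<^sup>2 \<le> (norm (x (t0 + real k * T)))\<^sup>2 - \<kappa>"
      proof (rule \<kappa>[rule_format], intro conjI)
        show "0 \<le> t0 + real k * T" using \<open>0 \<le> t0\<close> pos by simp
        have "{t0 + real k * T..t0 + real k * T + T} \<subseteq> {t0..t}" using le eq pos by auto
        then show "{t0 + real k * T..t0 + real k * T + T} \<subseteq> J" using sub by (rule subset_trans)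
        show "ode_solution_on ?f J x" by (rule ode)
        show "\<eta> \<le> norm (x (t0 + real k * T))" using le eq pos \<open>0 < T\<close> by (intro ge) auto
      qed
      also have "(norm (x (t0 + real k * T)))\<^sup>2 \<le> (norm (x t0))\<^sup>2 - real k * \<kappa>" using Suc by simp
      finally show ?case unfolding eq by (simp add: algebra_simps)
    qed simp
    from this[of n] have "real n * \<kappa> \<le> (norm (x t0))\<^sup>2"
      using zero_le_power2[of "norm (x (t0 + real n * T))"] by linarith
    also have "\<dots> \<le> c\<^sup>2" using c by (intro power_mono) auto
    finally show False using n by simp
  qed
  then show "\<exists>T>0. \<forall>t0\<ge>0. \<forall>J x. solution_from ?f t0 J x \<and> norm (x t0) < c \<longrightarrow>
      (\<forall>t\<in>J. t0 + T \<le> t \<longrightarrow> norm (x t) < \<eta>)"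
    using \<open>0 < n\<close> \<open>0 < T\<close> by (intro exI[of _ "real n * T"]) auto
qed

subsection \<open>Existence for bounded dissipative fields\<close>

text \<open>Delay \<open>1 / Suc n\<close> with \<open>(Suc n)\<^sup>2\<close> iterations covers a
  time horizon of \<open>Suc n\<close>: the delay vanishes while the horizon grows.\<close>

lemma Suc_square_mult_inverse: "real ((Suc n)\<^sup>2) * (1 / real (Suc n)) = real (Suc n)"
proof -
  have "r\<^sup>2 * (1 / r) = r" if "r \<noteq> 0" for r :: real
    using that by (simp add: power2_eq_square)
  from this[of "real (Suc n)"] show ?thesis unfolding of_nat_power by simp
qed

text \<open>The field may jump in time, so continuity in time is asked only along continuous curves
  and off \<open>S\<close>; this suffices to integrate \<open>F s (y s)\<close> and to differentiate
  the integral. The global bound makes all approximations Lipschitz with the same constant.\<close>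

locale bounded_dissipative_field =
  fixes F :: "real \<Rightarrow> 'a::euclidean_space \<Rightarrow> 'a" and S :: "real set" and t0 M :: real
  assumes finite_discontinuities: "finite (S \<inter> {t0..b})"
    and continuous_along: "t \<in> {t0..} - S \<Longrightarrow> continuous (at t within {t0..}) y \<Longrightarrow>
      continuous (at t within {t0..}) (\<lambda>s. F s (y s))"
    and continuous_state: "t0 \<le> t \<Longrightarrow> isCont (F t) z"
    and bound: "t0 \<le> t \<Longrightarrow> norm (F t z) \<le> M"
    and dissipative: "t0 \<le> t \<Longrightarrow> (w - z) \<bullet> (F t w - F t z) \<le> 0"
begin

lemma bound_nonneg: "0 \<le> M"
  using bound[of t0 0] norm_ge_zero order_trans by blast

lemma integrable_along:
  assumes "continuous_on {t0..} y" "t0 \<le> a"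
  shows "(\<lambda>s. F s (y s)) integrable_on {a..b}"
proof (rule bounded_continuous_off_finite_integrable[OF finite_discontinuities[of b]])
  show "continuous_on ({a..b} - S \<inter> {t0..b}) (\<lambda>s. F s (y s))"
    unfolding continuous_on_eq_continuous_within
  proof
    fix t assume t: "t \<in> {a..b} - S \<inter> {t0..b}"
    then have "continuous (at t within {t0..}) y"
      using assms by (simp add: continuous_on_eq_continuous_within)
    with t assms(2) have "continuous (at t within {t0..}) (\<lambda>s. F s (y s))"
      by (intro continuous_along) auto
    then show "continuous (at t within {a..b} - S \<inter> {t0..b}) (\<lambda>s. F s (y s))"
      by (rule continuous_within_subset) (use assms(2) in auto)
  qed
  show "norm (F t (y t)) \<le> M" if "t \<in> {a..b}" for t
    using bound that assms(2) by simp
qed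

lemma integral_along_lipschitz:
  assumes "continuous_on {t0..} y"
  shows "norm (integral {t0..t} (\<lambda>s. F s (y s)) - integral {t0..r} (\<lambda>s. F s (y s))) \<le> M * \<bar>t - r\<bar>"
proof -
  let ?I = "\<lambda>t. integral {t0..t} (\<lambda>s. F s (y s))"
  \<comment> \<open>Before \<open>t0\<close> the integral is over an empty interval, hence 0. The
    Lipschitz bound thus extends to all reals, as delayed arguments below \<open>t0\<close>
    require.\<close>
  have clip: "?I t = ?I (max t0 t)" for t by (cases "t < t0") (auto simp: max_def)
  have main: "norm (?I t - ?I r) \<le> M * (t - r)" if "t0 \<le> r" "r \<le> t" for r t
  proof -
    have "?I r + integral {r..t} (\<lambda>s. F s (y s)) = ?I t"
      by (rule Henstock_Kurzweil_Integration.integral_combine[OF that])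
        (rule integrable_along[OF assms order_refl])
    then have "?I t - ?I r = integral {r..t} (\<lambda>s. F s (y s))" by (simp add: algebra_simps)
    also have "norm \<dots> \<le> integral {r..t} (\<lambda>_. M)"
      using that by (intro integral_norm_bound_integral integrable_along assms bound) auto
    also have "\<dots> = M * (t - r)" using that by simp
    finally show ?thesis .
  qed
  have "norm (?I t - ?I r) \<le> M * \<bar>t - r\<bar>" if "t0 \<le> r" "t0 \<le> t" for r t
    using main[of r t] main[of t r] that
    by (cases "r \<le> t") (simp_all add: norm_minus_commute)
  then have "norm (?I (max t0 t) - ?I (max t0 r)) \<le> M * \<bar>max t0 t - max t0 r\<bar>"
    by (meson max.cobounded1)
  also have "\<dots> \<le> M * \<bar>t - r\<bar>"
    by (intro mult_left_mono bound_nonneg) auto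
  finally show ?thesis using clip[of t] clip[of r] by simp
qed

lemma lipschitz_continuous_on:
  assumes "\<And>s t. norm (y t - y s :: 'a) \<le> M * \<bar>t - s\<bar>"
  shows "continuous_on A y"
proof -
  have "M-lipschitz_on A y"
    using assms bound_nonneg by (intro lipschitz_onI) (auto simp: dist_norm)
  then show ?thesis by (rule lipschitz_on_continuous_on)
qed

section \<open>Approximation by delay equations\<close>

definition delay_step :: "'a \<Rightarrow> real \<Rightarrow> (real \<Rightarrow> 'a) \<Rightarrow> real \<Rightarrow> 'a"
  where "delay_step x0 h y t = x0 + integral {t0..t} (\<lambda>s. F s (y (s - h)))"

text \<open>The method of steps written as iteration of total functions from the constant
  \<open>x0\<close>: the \<open>k\<close>-th iterate solves the delay equation up to
  \<open>t0 + k * h\<close>.\<close>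

definition delay_approx :: "'a \<Rightarrow> real \<Rightarrow> nat \<Rightarrow> real \<Rightarrow> 'a"
  where "delay_approx x0 h k = (delay_step x0 h ^^ k) (\<lambda>_. x0)"

lemma delay_approx_Suc:
  "delay_approx x0 h (Suc k) t = x0 + integral {t0..t} (\<lambda>s. F s (delay_approx x0 h k (s - h)))"
  by (simp add: delay_approx_def delay_step_def)

lemma delay_approx_before: "t \<le> t0 \<Longrightarrow> delay_approx x0 h k t = x0"
  by (cases k; cases "t = t0") (simp_all add: delay_approx_Suc, simp_all add: delay_approx_def)

text \<open>The constant is independent of \<open>h\<close> and \<open>k\<close>, so it also passes
  to the limit.\<close>

lemma delay_approx_lipschitz:
  "norm (delay_approx x0 h k t - delay_approx x0 h k s) \<le> M * \<bar>t - s\<bar>"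
proof (induction k arbitrary: s t)
  case 0
  then show ?case using bound_nonneg by (simp add: delay_approx_def)
next
  case (Suc k)
  have "continuous_on {t0..} (\<lambda>s. delay_approx x0 h k (s - h))"
    by (rule lipschitz_continuous_on) (use Suc[of "_ - h" "_ - h"] in simp)
  then show ?case using integral_along_lipschitz by (simp add: delay_approx_Suc)
qed

text \<open>For times up to \<open>t0 + Suc k * h\<close> the integrand reads the previous iterate
  only up to \<open>t0 + k * h\<close>, where by induction two successive iterates agree.\<close>

lemma delay_approx_Suc_eq:
  "t \<le> t0 + real k * h \<Longrightarrow> delay_approx x0 h (Suc k) t = delay_approx x0 h k t"
proof (induction k arbitrary: t)
  case 0
  then show ?case by (simp add: delay_approx_before)
next
  case (Suc k)
  have "delay_approx x0 h (Suc k) (s - h) = delay_approx x0 h k (s - h)" if "s \<in> {t0..t}" for s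
    using that Suc.prems by (intro Suc.IH) (auto simp: algebra_simps)
  then show ?case
    unfolding delay_approx_Suc[of x0 h "Suc k"] delay_approx_Suc[of x0 h k]
    by (intro arg_cong2[where f = "(+)"] refl integral_cong) (simp add: delay_approx_Suc)
qed

lemma delay_approx_equation:
  assumes "t \<le> t0 + real k * h"
  shows "delay_approx x0 h k t = x0 + integral {t0..t} (\<lambda>s. F s (delay_approx x0 h k (s - h)))"
  using delay_approx_Suc_eq[OF assms, of x0] by (simp add: delay_approx_Suc)

text \<open>The equation is assumed on \<open>{t0..b}\<close> only, because an iterate satisfies it
  only up to its horizon. The case \<open>h = 0\<close> serves the limit equation.\<close>

lemma delay_equation_derivative:
  assumes lip: "\<And>s t. norm (X t - X s) \<le> M * \<bar>t - s\<bar>"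
    and eq: "\<And>t. t \<in> {t0..b} \<Longrightarrow> X t = x0 + integral {t0..t} (\<lambda>s. F s (X (s - h)))"
    and t: "t \<in> {t0..b} - S"
  shows "(X has_vector_derivative F t (X (t - h))) (at t within {t0..b})"
proof -
  have cont: "continuous_on {t0..} (\<lambda>s. X (s - h))"
    by (rule lipschitz_continuous_on) (use lip[of "_ - h" "_ - h"] in simp)
  have "continuous (at t within {t0..}) (\<lambda>s. F s (X (s - h)))"
    using t cont by (intro continuous_along) (auto simp: continuous_on_eq_continuous_within)
  then have "continuous (at t within {t0..b} - {}) (\<lambda>s. F s (X (s - h)))"
    by (rule continuous_within_subset) auto
  from integral_has_vector_derivative_continuous_at[OF integrable_along[OF cont order_refl] _ _ this]
  have "((\<lambda>t. integral {t0..t} (\<lambda>s. F s (X (s - h)))) has_vector_derivative F t (X (t - h)))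
      (at t within {t0..b})"
    using t by simp
  from has_vector_derivative_add[OF has_vector_derivative_const this, of x0]
  have "((\<lambda>t. x0 + integral {t0..t} (\<lambda>s. F s (X (s - h)))) has_vector_derivative F t (X (t - h)))
      (at t within {t0..b})"
    by simp
  then show ?thesis
    by (rule has_vector_derivative_transform[rotated 2]) (use t eq in auto)
qed

text \<open>Up to an error proportional to the delays, dissipativity makes the squared distance
  nonincreasing.\<close>

lemma delay_equation_close:
  assumes lipX: "\<And>s t. norm (X t - X s) \<le> M * \<bar>t - s\<bar>"
    and lipY: "\<And>s t. norm (Y t - Y s) \<le> M * \<bar>t - s\<bar>"
    and eqX: "\<And>t. t \<in> {t0..b} \<Longrightarrow> X t = x0 + integral {t0..t} (\<lambda>s. F s (X (s - h)))"
    and eqY: "\<And>t. t \<in> {t0..b} \<Longrightarrow> Y t = x0 + integral {t0..t} (\<lambda>s. F s (Y (s - k)))"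
    and "0 \<le> h" "0 \<le> k" "t0 \<le> b"
  shows "(norm (X b - Y b))\<^sup>2 \<le> 4 * M\<^sup>2 * (h + k) * (b - t0)"
proof -
  let ?d = "\<lambda>t. F t (X (t - h)) - F t (Y (t - k))"
  have "((\<lambda>t. 2 * ((X t - Y t) \<bullet> ?d t)) has_integral
      ((X b - Y b) \<bullet> (X b - Y b) - (X t0 - Y t0) \<bullet> (X t0 - Y t0))) {t0..b}"
  proof (rule fundamental_theorem_of_calculus_interior_strong[OF finite_discontinuities[of b] \<open>t0 \<le> b\<close>])
    fix t assume t: "t \<in> {t0<..<b} - S \<inter> {t0..b}"
    then have tS: "t \<in> {t0..b} - S" by auto
    have "(X has_vector_derivative F t (X (t - h))) (at t within {t0..b})"
      by (rule delay_equation_derivative[of X b x0 h, OF lipX eqX tS])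
    moreover have "(Y has_vector_derivative F t (Y (t - k))) (at t within {t0..b})"
      by (rule delay_equation_derivative[of Y b x0 k, OF lipY eqY tS])
    ultimately have "((\<lambda>t. X t - Y t) has_vector_derivative ?d t) (at t within {t0..b})"
      by (rule has_vector_derivative_diff)
    moreover have "at t within {t0..b} = at t" by (rule at_within_interior) (use t in simp)
    ultimately have *: "((\<lambda>t. X t - Y t) has_vector_derivative ?d t) (at t)" by simp
    show "((\<lambda>t. (X t - Y t) \<bullet> (X t - Y t)) has_vector_derivative 2 * ((X t - Y t) \<bullet> ?d t)) (at t)"
      using bounded_bilinear.has_vector_derivative[OF bounded_bilinear_inner * *]
      by (simp add: inner_commute)
  next
    show "continuous_on {t0..b} (\<lambda>t. (X t - Y t) \<bullet> (X t - Y t))"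
      by (intro continuous_intros lipschitz_continuous_on lipX lipY)
  qed
  moreover have "X t0 = Y t0" using eqX[of t0] eqY[of t0] \<open>t0 \<le> b\<close> by simp
  ultimately have "((\<lambda>t. 2 * ((X t - Y t) \<bullet> ?d t)) has_integral (norm (X b - Y b))\<^sup>2) {t0..b}"
    by (simp add: power2_norm_eq_inner)
  moreover have "((\<lambda>_. 4 * M\<^sup>2 * (h + k)) has_integral 4 * M\<^sup>2 * (h + k) * (b - t0)) {t0..b}"
    using has_integral_const_real[of "4 * M\<^sup>2 * (h + k)" t0 b] \<open>t0 \<le> b\<close> by (simp add: mult.commute)
  moreover have "2 * ((X t - Y t) \<bullet> ?d t) \<le> 4 * M\<^sup>2 * (h + k)" if t: "t \<in> {t0..b}" for t
  proof -
    \<comment> \<open>Dissipativity gives a sign only to the difference of the delayed states. The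
      remainder \<open>?e\<close> has norm at most \<open>M * (h + k)\<close>, and its product with
      a field difference of norm at most \<open>2 * M\<close> yields the constant
      \<open>4 * M\<^sup>2 * (h + k)\<close>.\<close>
    let ?e = "(X t - X (t - h)) - (Y t - Y (t - k))"
    have "norm ?e \<le> M * h + M * k"
      using lipX[of t "t - h"] lipY[of t "t - k"] \<open>0 \<le> h\<close> \<open>0 \<le> k\<close>
        norm_triangle_ineq4[of "X t - X (t - h)" "Y t - Y (t - k)"] by simp
    moreover have "norm (?d t) \<le> M + M"
      using t by (intro order_trans[OF norm_triangle_ineq4] add_mono bound) auto
    ultimately have "norm ?e * norm (?d t) \<le> (M * h + M * k) * (M + M)"
      using bound_nonneg \<open>0 \<le> h\<close> \<open>0 \<le> k\<close> by (intro mult_mono) auto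
    moreover have "?e \<bullet> ?d t \<le> norm ?e * norm (?d t)" by (rule norm_cauchy_schwarz)
    moreover have "(X (t - h) - Y (t - k)) \<bullet> ?d t \<le> 0" using t by (intro dissipative) auto
    moreover have "(X t - Y t) \<bullet> ?d t = ?e \<bullet> ?d t + (X (t - h) - Y (t - k)) \<bullet> ?d t"
      unfolding inner_add_left[symmetric] by simp
    ultimately show ?thesis by (simp add: algebra_simps power2_eq_square)
  qed
  ultimately show ?thesis by (rule has_integral_le)
qed

lemma delay_approx_Cauchy:
  assumes "t0 \<le> t"
  shows "Cauchy (\<lambda>n. delay_approx x0 (1 / real (Suc n)) ((Suc n)\<^sup>2) t)"
proof (rule CauchyI)
  let ?X = "\<lambda>n. delay_approx x0 (1 / real (Suc n)) ((Suc n)\<^sup>2)"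
  fix e :: real assume "0 < e"
  obtain N1 where N1: "t - t0 \<le> real N1" using real_arch_simple by blast
  \<comment> \<open>\<open>N1\<close> puts \<open>t\<close> inside the horizon of both
    approximations; \<open>N2\<close> makes the distance estimate, with both delays at most
    \<open>1 / Suc N\<close>, smaller than \<open>e\<^sup>2\<close>.\<close>
  obtain N2 where N2: "8 * M\<^sup>2 * (t - t0) / e\<^sup>2 < real N2" using reals_Archimedean2 by blast
  define N where "N = max N1 N2"
  have "norm (?X m t - ?X n t) < e" if "N \<le> m" "N \<le> n" for m n
  proof -
    have N1': "t - t0 \<le> real N" using N1 by (simp add: N_def)
    have eq: "?X n s = x0 + integral {t0..s} (\<lambda>r. F r (?X n (r - 1 / real (Suc n))))"
      if "N \<le> n" "s \<in> {t0..t}" for n s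
    proof (rule delay_approx_equation)
      have "real ((Suc n)\<^sup>2) * (1 / real (Suc n)) = real (Suc n)"
        by (rule Suc_square_mult_inverse)
      then show "s \<le> t0 + real ((Suc n)\<^sup>2) * (1 / real (Suc n))"
        using that N1' by simp
    qed
    have "(norm (?X m t - ?X n t))\<^sup>2 \<le> 4 * M\<^sup>2 * (1 / real (Suc m) + 1 / real (Suc n)) * (t - t0)"
      by (rule delay_equation_close[OF delay_approx_lipschitz delay_approx_lipschitz
            eq[OF that(1)] eq[OF that(2)]]) (use assms in auto)
    also have "\<dots> \<le> 4 * M\<^sup>2 * (1 / real (Suc N) + 1 / real (Suc N)) * (t - t0)"
      using assms that by (intro mult_right_mono mult_left_mono add_mono divide_left_mono) auto
    also have "\<dots> = 8 * M\<^sup>2 * (t - t0) / real (Suc N)" by (simp add: field_simps)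
    also have "\<dots> < e\<^sup>2"
    proof -
      have "8 * M\<^sup>2 * (t - t0) / e\<^sup>2 < real (Suc N)" using N2 by (simp add: N_def)
      then show ?thesis using \<open>0 < e\<close> by (simp add: divide_less_eq mult.commute del: of_nat_Suc)
    qed
    finally show ?thesis using \<open>0 < e\<close> by (simp add: power2_less_imp_less)
  qed
  then show "\<exists>N. \<forall>m\<ge>N. \<forall>n\<ge>N. norm (?X m t - ?X n t) < e" by blast
qed

text \<open>Pointwise convergence is enough: the common Lipschitz bound absorbs the vanishing delay,
  continuity in the state gives convergence of the integrands, and \<open>M\<close> dominates
  them.\<close>

lemma integral_equation_solvable:
  "\<exists>x. (\<forall>s t. norm (x t - x s) \<le> M * \<bar>t - s\<bar>) \<and>
    (\<forall>t\<ge>t0. x t = x0 + integral {t0..t} (\<lambda>s. F s (x s)))"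
proof -
  define h where "h n = 1 / real (Suc n)" for n
  define X where "X n = delay_approx x0 (h n) ((Suc n)\<^sup>2)" for n
  define x where "x t = lim (\<lambda>n. X n t)" for t
  have "convergent (\<lambda>n. X n t)" for t
  proof (cases "t0 \<le> t")
    case True
    then show ?thesis using delay_approx_Cauchy by (simp add: X_def h_def Cauchy_convergent)
  next
    case False
    then have "X n t = x0" for n by (simp add: X_def delay_approx_before)
    then show ?thesis by (simp add: convergent_const)
  qed
  then have lim: "(\<lambda>n. X n t) \<longlonglongrightarrow> x t" for t by (simp add: x_def convergent_LIMSEQ_iff)
  have lipX: "norm (X n t - X n s) \<le> M * \<bar>t - s\<bar>" for n s t
    unfolding X_def by (rule delay_approx_lipschitz)
  have lip: "norm (x t - x s) \<le> M * \<bar>t - s\<bar>" for s t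
    by (rule LIMSEQ_le_const2[OF tendsto_norm[OF tendsto_diff[OF lim lim]]]) (use lipX in blast)
  have h: "h \<longlonglongrightarrow> 0" unfolding h_def by (rule lim_inverse_n'[THEN LIMSEQ_Suc])
  have limd: "(\<lambda>n. X n (t - h n)) \<longlonglongrightarrow> x t" for t
  proof -
    have "(\<lambda>n. X n (t - h n) - X n t) \<longlonglongrightarrow> 0"
    proof (rule Lim_null_comparison)
      show "\<forall>\<^sub>F n in sequentially. norm (X n (t - h n) - X n t) \<le> M * \<bar>h n\<bar>"
        using lipX[of _ "t - h _" t] by simp
      show "(\<lambda>n. M * \<bar>h n\<bar>) \<longlonglongrightarrow> 0" using tendsto_mult[OF tendsto_const tendsto_rabs[OF h], of M] by simp
    qed
    from tendsto_add[OF this lim[of t]] show ?thesis by simp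
  qed
  have eq: "x t = x0 + integral {t0..t} (\<lambda>s. F s (x s))" if "t0 \<le> t" for t
  proof (rule LIMSEQ_unique[OF lim])
    have "(\<lambda>n. integral {t0..t} (\<lambda>s. F s (X n (s - h n)))) \<longlonglongrightarrow> integral {t0..t} (\<lambda>s. F s (x s))"
    proof (rule dominated_convergence(2))
      show "(\<lambda>s. F s (X n (s - h n))) integrable_on {t0..t}" for n
        by (intro integrable_along lipschitz_continuous_on order_refl)
          (use lipX[of n "_ - h n" "_ - h n"] in simp)
      show "(\<lambda>_. M) integrable_on {t0..t}" by (rule integrable_const_ivl)
      show "norm (F s (X n (s - h n))) \<le> M" if "s \<in> {t0..t}" for n s using that bound by simp
      show "(\<lambda>n. F s (X n (s - h n))) \<longlonglongrightarrow> F s (x s)" if "s \<in> {t0..t}" for s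
        using that by (intro isCont_tendsto_compose[OF continuous_state limd]) simp
    qed
    then have "(\<lambda>n. x0 + integral {t0..t} (\<lambda>s. F s (X n (s - h n)))) \<longlonglongrightarrow>
        x0 + integral {t0..t} (\<lambda>s. F s (x s))"
      by (intro tendsto_intros)
    moreover have "\<forall>\<^sub>F n in sequentially. X n t = x0 + integral {t0..t} (\<lambda>s. F s (X n (s - h n)))"
    proof -
      obtain N where N: "t - t0 \<le> real N" using real_arch_simple by blast
      have "X n t = x0 + integral {t0..t} (\<lambda>s. F s (X n (s - h n)))" if "N \<le> n" for n
        unfolding X_def
      proof (rule delay_approx_equation)
        have "real ((Suc n)\<^sup>2) * h n = real (Suc n)"
          unfolding h_def by (rule Suc_square_mult_inverse)
        then show "t \<le> t0 + real ((Suc n)\<^sup>2) * h n" using that N by simp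
      qed
      then show ?thesis by (rule eventually_sequentiallyI)
    qed
    ultimately show "(\<lambda>n. X n t) \<longlonglongrightarrow> x0 + integral {t0..t} (\<lambda>s. F s (x s))"
      by (rule tendsto_cong[THEN iffD2, rotated])
  qed
  show ?thesis by (intro exI[of _ x] conjI allI impI lip eq)
qed

lemma ode_solution_exists:
  assumes "negligible S"
  obtains x where "x t0 = x0" "ode_solution_on F {t0..} x"
proof -
  obtain x where lip: "norm (x t - x s) \<le> M * \<bar>t - s\<bar>"
    and eq: "t0 \<le> t \<Longrightarrow> x t = x0 + integral {t0..t} (\<lambda>s. F s (x s))" for s t
    using integral_equation_solvable[of x0] by metis
  have der: "(x has_vector_derivative F t (x t)) (at t within {t0..})" if t: "t \<in> {t0..} - S" for t
  proof -
    \<comment> \<open>The limit satisfies the delay equation with delay 0; the right end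
      \<open>t + 1\<close> keeps \<open>t\<close> away from the upper boundary.\<close>
    have "(x has_vector_derivative F t (x (t - 0))) (at t within {t0..t + 1})"
      by (rule delay_equation_derivative[OF lip, of _ x0]) (use eq t in auto)
    moreover have "at t within {t0..t + 1} = at t within {t0..}"
      by (rule at_within_nhd[of _ "{..<t + 1}"]) auto
    ultimately show ?thesis by simp
  qed
  have "ode_solution_on F {t0..} x"
    unfolding ode_solution_on_def
  proof (intro conjI allI impI)
    show "absolutely_continuous_fun_on {a..b} x" for a b
      by (rule lipschitz_absolutely_continuous_fun_on[OF lip])
    have "S \<in> null_sets lebesgue" using assms by (simp add: negligible_iff_null_sets)
    then have "AE t in lebesgue. t \<notin> S" by (rule AE_not_in)
    then show "AE t\<in>{t0..} in lebesgue. (x has_vector_derivative F t (x t)) (at t within {t0..})"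
      by eventually_elim (use der in auto)
  qed
  then show ?thesis using eq[of t0] that by simp
qed

end

subsection \<open>Existence for the truncated system\<close>

text \<open>Splitting into positive and negative parts gives continuity across 0 and monotonicity
  from those of \<open>powr\<close> on nonnegative numbers.\<close>

lemma signed_powr_eq_diff: "0 < p \<Longrightarrow> signed_powr w p = max w 0 powr p - max (- w) 0 powr p"
  by (cases w "0::real" rule: linorder_cases) (simp_all add: signed_powr_def)

lemma isCont_signed_powr: "0 < p \<Longrightarrow> isCont (\<lambda>w. signed_powr w p) w"
proof -
  assume "0 < p"
  have "continuous_on UNIV (\<lambda>w. max w 0 powr p - max (- w) 0 powr p)"
    by (intro continuous_intros continuous_on_powr') (use \<open>0 < p\<close> in auto)
  then show ?thesis
    using \<open>0 < p\<close> by (simp add: signed_powr_eq_diff continuous_on_eq_continuous_at)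
qed

lemma signed_powr_mono: "0 < p \<Longrightarrow> v \<le> w \<Longrightarrow> signed_powr v p \<le> signed_powr w p"
  unfolding signed_powr_eq_diff by (intro diff_mono powr_mono2) auto

text \<open>Clipping the argument bounds the nonlinearity by \<open>R powr p\<close> while keeping
  it continuous and monotone.\<close>

definition truncated_powr :: "real \<Rightarrow> real \<Rightarrow> real \<Rightarrow> real"
  where "truncated_powr R p w = signed_powr (max (- R) (min R w)) p"

lemma truncated_powr_eq: "\<bar>w\<bar> \<le> R \<Longrightarrow> truncated_powr R p w = signed_powr w p"
  unfolding truncated_powr_def by (rule arg_cong[where f = "\<lambda>w. signed_powr w p"]) auto

lemma isCont_truncated_powr:
  assumes "0 < p"
  shows "isCont (truncated_powr R p) w"
proof -
  have "isCont (\<lambda>w. max (- R) (min R w)) w" by (intro continuous_intros)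
  from isCont_o2[OF this isCont_signed_powr[OF assms]] show ?thesis
    by (simp add: truncated_powr_def[abs_def])
qed

lemma truncated_powr_mono:
  assumes "0 < p" "v \<le> w"
  shows "truncated_powr R p v \<le> truncated_powr R p w"
  unfolding truncated_powr_def by (intro signed_powr_mono max.mono min.mono order_refl assms)

lemma abs_truncated_powr_le: "0 < p \<Longrightarrow> 0 \<le> R \<Longrightarrow> \<bar>truncated_powr R p w\<bar> \<le> R powr p"
  unfolding truncated_powr_def abs_signed_powr by (intro powr_mono2) auto

text \<open>Monotonicity as a product inequality: applied to \<open>u t \<bullet> w\<close> and
  \<open>u t \<bullet> z\<close>, it is the dissipativity of the truncated field.\<close>

lemma truncated_powr_diff_mult_nonneg:
  "0 < p \<Longrightarrow> 0 \<le> (v - w) * (truncated_powr R p v - truncated_powr R p w)"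
  using truncated_powr_mono[of p v w R] truncated_powr_mono[of p w v R]
  by (cases "v \<le> w") (auto simp: mult_nonneg_nonneg mult_nonpos_nonpos)

lemma piecewise_continuous_finite_discontinuities:
  assumes "piecewise_continuous u" "0 \<le> t0"
  shows "finite ({t. \<not> continuous (at t within {0..}) u} \<inter> {t0..b})"
proof -
  obtain S where "finite S" and S: "\<forall>t\<in>{0..max 0 b} - S. continuous (at t within {0..}) u"
    using assms(1) unfolding piecewise_continuous_def by (meson max.cobounded1)
  have "{t. \<not> continuous (at t within {0..}) u} \<inter> {t0..b} \<subseteq> S" using S assms(2) by auto
  then show ?thesis using \<open>finite S\<close> by (rule finite_subset)
qed

text \<open>The filter is trivial there, so values at negative times create no
  discontinuities.\<close>

lemma continuous_within_outside_nonneg: "t < 0 \<Longrightarrow> continuous (at t within {0::real..}) u"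
  for u :: "real \<Rightarrow> 'a::topological_space"
proof -
  assume "t < 0"
  have "at t within {0..} = (bot :: real filter)"
    using \<open>t < 0\<close> by (simp add: at_within_eq_bot_iff)
  then show ?thesis by (simp add: continuous_bot)
qed

lemma piecewise_continuous_negligible_discontinuities:
  assumes "piecewise_continuous u"
  shows "negligible {t. \<not> continuous (at t within {0..}) u}"
proof -
  \<comment> \<open>Finiteness is available only on bounded intervals; exhausting the half-line by
    them gives a countable set.\<close>
  have "{t. \<not> continuous (at t within {0..}) u} =
      (\<Union>n. {t. \<not> continuous (at t within {0..}) u} \<inter> {0..real n})" (is "?S = ?U")
  proof
    show "?S \<subseteq> ?U"
    proof
      fix t assume t: "t \<in> ?S"
      then have "0 \<le> t" using continuous_within_outside_nonneg[of t u] by (cases "0 \<le> t") auto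
      moreover obtain n where "t \<le> real n" using real_arch_simple by blast
      ultimately show "t \<in> ?U" using t by auto
    qed
  qed auto
  moreover have "countable ?U"
    using piecewise_continuous_finite_discontinuities[OF assms order_refl]
    by (intro countable_UN countable_finite[of "_ \<inter> _"]) auto
  ultimately show ?thesis by (simp add: negligible_iff_null_sets countable_imp_null_set_lborel null_sets_completionI)
qed

section \<open>Forward completeness and uniform stability\<close>

lemma excitation_forward_complete:
  fixes u :: "real \<Rightarrow> 'a::euclidean_space"
  assumes pc: "piecewise_continuous u" and M: "\<And>t. 0 \<le> t \<Longrightarrow> norm (u t) \<le> M" and "0 < p"
  shows "forward_complete (\<lambda>t y. - (signed_powr (u t \<bullet> y) p *\<^sub>R u t))"
  unfolding forward_complete_def
proof (intro allI impI)
  fix t0 :: real and x0 :: 'a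
  assume "0 \<le> t0"
  define S where "S = {t. \<not> continuous (at t within {0..}) u}"
  \<comment> \<open>As long as the norm of the state does not exceed its initial value,
    Cauchy-Schwarz gives \<open>\<bar>u t \<bullet> x t\<bar> \<le> M * norm x0\<close>.\<close>
  define R where "R = M * norm x0"
  define F where "F t y = - (truncated_powr R p (u t \<bullet> y) *\<^sub>R u t)" for t y
  have "0 \<le> M" using M[of 0] norm_ge_zero order_trans by blast
  then have "0 \<le> R" by (simp add: R_def)
  interpret bounded_dissipative_field F S t0 "R powr p * M"
  proof
    show "finite (S \<inter> {t0..b})" for b
      unfolding S_def by (rule piecewise_continuous_finite_discontinuities[OF pc \<open>0 \<le> t0\<close>])
  next
    fix t and y :: "real \<Rightarrow> 'a"
    assume t: "t \<in> {t0..} - S" and y: "continuous (at t within {t0..}) y"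
    have "continuous (at t within {0..}) u" using t by (simp add: S_def)
    then have "continuous (at t within {t0..}) u"
      by (rule continuous_within_subset) (use \<open>0 \<le> t0\<close> in auto)
    then have u: "(u \<longlongrightarrow> u t) (at t within {t0..})" by (simp add: continuous_within)
    have "((\<lambda>s. u s \<bullet> y s) \<longlongrightarrow> u t \<bullet> y t) (at t within {t0..})"
      using y by (intro tendsto_inner u) (simp add: continuous_within)
    from isCont_tendsto_compose[OF isCont_truncated_powr[OF \<open>0 < p\<close>] this]
    have "((\<lambda>s. truncated_powr R p (u s \<bullet> y s)) \<longlongrightarrow> truncated_powr R p (u t \<bullet> y t)) (at t within {t0..})" .
    then show "continuous (at t within {t0..}) (\<lambda>s. F s (y s))"
      unfolding F_def continuous_within by (intro tendsto_minus tendsto_scaleR u)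
  next
    show "isCont (F t) z" for t z
      unfolding F_def[abs_def]
      by (intro continuous_minus continuous_scaleR continuous_const
          isCont_o2[OF _ isCont_truncated_powr[OF \<open>0 < p\<close>]]) (intro continuous_intros)
  next
    show "norm (F t z) \<le> R powr p * M" if "t0 \<le> t" for t z
      unfolding F_def norm_minus_cancel norm_scaleR
      using that \<open>0 \<le> t0\<close> \<open>0 < p\<close> \<open>0 \<le> R\<close>
      by (intro mult_mono abs_truncated_powr_le M) auto
  next
    show "(w - z) \<bullet> (F t w - F t z) \<le> 0" for t w z
    proof -
      have "(w - z) \<bullet> (F t w - F t z) =
          - ((u t \<bullet> w - u t \<bullet> z) * (truncated_powr R p (u t \<bullet> w) - truncated_powr R p (u t \<bullet> z)))"
        by (simp add: F_def inner_diff_left inner_diff_right inner_commute algebra_simps)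
      then show ?thesis using truncated_powr_diff_mult_nonneg[OF \<open>0 < p\<close>] by simp
    qed
  qed
  have "negligible S" unfolding S_def by (rule piecewise_continuous_negligible_discontinuities[OF pc])
  then obtain x where x0: "x t0 = x0" and sol: "ode_solution_on F {t0..} x"
    by (rule ode_solution_exists)
  \<comment> \<open>Dissipativity against the origin, where the truncated field vanishes.\<close>
  have F0: "y \<bullet> F t y \<le> 0" if "t \<in> {t0..}" for t y
    using dissipative[of t y 0] that \<open>0 \<le> R\<close>
    by (simp add: F_def truncated_powr_def signed_powr_def)
  \<comment> \<open>There is no circularity: the norm decreases along the truncated system itself,
    and this places \<open>u t \<bullet> x t\<close> in the range where both fields agree. Agreement
    along \<open>x\<close> is all that is claimed.\<close>
  have "F t (x t) = - (signed_powr (u t \<bullet> x t) p *\<^sub>R u t)" if t: "t \<in> {t0..}" for t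
  proof -
    have "norm (x t) \<le> norm (x t0)"
      by (rule ode_solution_on_norm_antimono[OF sol]) (use t F0 in auto)
    then have "norm (u t) * norm (x t) \<le> R"
      unfolding R_def using M[of t] t \<open>0 \<le> t0\<close> \<open>0 \<le> M\<close> x0 by (intro mult_mono) auto
    then have "\<bar>u t \<bullet> x t\<bar> \<le> R" using Cauchy_Schwarz_ineq2 order_trans by blast
    then show ?thesis by (simp add: F_def truncated_powr_eq)
  qed
  then have "ode_solution_on (\<lambda>t y. - (signed_powr (u t \<bullet> y) p *\<^sub>R u t)) {t0..} x"
    using sol unfolding ode_solution_on_def by (auto elim!: eventually_mono)
  then show "\<exists>x. solution_from (\<lambda>t y. - (signed_powr (u t \<bullet> y) p *\<^sub>R u t)) t0 {t0..} x \<and> x t0 = x0"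
    using x0 by (intro exI[of _ x]) (simp add: solution_from_def is_interval_ci)
qed

text \<open>The norm is nonincreasing along every solution, so \<delta> can be the identity, which
  also tends to infinity as global stability demands.\<close>

lemma uniformly_stable_with_id:
  assumes "\<And>t y. 0 \<le> t \<Longrightarrow> y \<bullet> f t y \<le> 0"
  shows "uniformly_stable_with f (\<lambda>\<epsilon>. \<epsilon>)"
  unfolding uniformly_stable_with_def
proof (intro allI impI conjI ballI)
  fix \<epsilon> t0 :: real and J x t
  assume "0 \<le> t0" and sol: "solution_from f t0 J x \<and> norm (x t0) < \<epsilon>" and t: "t \<in> J"
  have ode: "ode_solution_on f J x" and sub: "{t0..t} \<subseteq> J" "t0 \<le> t" and "J \<subseteq> {t0..}"
    using sol t unfolding solution_from_def is_interval_1 by auto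
  have "norm (x t) \<le> norm (x t0)"
    by (rule ode_solution_on_norm_antimono[OF ode sub assms]) (use \<open>0 \<le> t0\<close> \<open>J \<subseteq> {t0..}\<close> in auto)
  then show "norm (x t) < \<epsilon>" using sol by simp
qed

theorem theorem4:
  fixes u :: "real \<Rightarrow> real ^ 'n" and u\<^sub>M p :: real
  assumes "piecewise_continuous u"
    and "persistently_exciting u"
    and "\<And>t. t \<ge> 0 \<Longrightarrow> norm (u t) \<le> u\<^sub>M"
    and "p > 0"
  shows "globally_uniformly_asymptotically_stable
           (\<lambda>t x. - (signed_powr (u t \<bullet> x) p *\<^sub>R u t))"
  unfolding globally_uniformly_asymptotically_stable_def
proof (intro conjI exI)
  show "forward_complete (\<lambda>t x. - (signed_powr (u t \<bullet> x) p *\<^sub>R u t))"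
    using assms by (intro excitation_forward_complete)
  show "globally_uniformly_attractive (\<lambda>t x. - (signed_powr (u t \<bullet> x) p *\<^sub>R u t))"
    using assms by (intro excitation_attractive)
  show "uniformly_stable_with (\<lambda>t x. - (signed_powr (u t \<bullet> x) p *\<^sub>R u t)) (\<lambda>\<epsilon>. \<epsilon>)"
  proof (rule uniformly_stable_with_id)
    show "y \<bullet> - (signed_powr (u t \<bullet> y) p *\<^sub>R u t) \<le> 0" for t y
      using mult_signed_powr[of "u t \<bullet> y" p] by (simp add: inner_commute mult.commute)
  qed
qed (rule filterlim_ident)

end
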